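(* Let $K\subset\mathbb{R}^n$ be an $o$-symmetric convex body with non-empty interior, let $\Lambda\subset\mathbb{R}^n$ be a lattice with $\operatorname{rank}\Lambda=n\ge 2$, and let $\Lambda_i\subset\Lambda$, $1\le i\le s$, be sublattices with $1\le\operatorname{rank}\Lambda_i\le n-1$. Then $$\lambda_1\Bigl(K,\Lambda\setminus\bigcup_{i=1}^s\Lambda_i\Bigr)<6^{n-1}\frac{\det\Lambda}{\lambda_1(K,\Lambda)^{n-2}\operatorname{vol}(K)}\left(\sum_{i=1}^s\frac{1}{\lambda_1(K,\Lambda_i)}\right)+\sqrt[n]{2^n\frac{\det\Lambda}{\operatorname{vol}(K)}}.$$
   Context: An $o$-symmetric convex body is a compact convex set $K\subset\mathbb{R}^n$ with $K=-K$; $\operatorname{vol}$ is $n$-dimensional Lebesgue measure. A lattice $\Lambda\subset\mathbb{R}^n$ is a discrete additive subgroup (the $\mathbb{Z}$-span of $r$ linearly independent vectors, $r=\operatorname{rank}\Lambda\le n$); $\det\Lambda$ is the $r$-dimensional volume of a fundamental cell of $\Lambda$. For a set $X\subset\mathbb{R}^n$, $\dim X$ denotes here the dimension of its linear span (the maximal number of linearly independent points of $X$). The successive minima are $\lambda_i(K,\Lambda)=\min\{\lambda\ge 0:\dim(\lambda K\cap\Lambda)\ge i\}$ for $1\le i\le\operatorname{rank}\Lambda$. For sublattices $\Lambda_1,\dots,\Lambda_s\subset\Lambda$ with $\bigcup_{i=1}^s\Lambda_i\neq\Lambda$ the $j$-th restricted successive minimum is $\lambda_j(K,\Lambda\setminus\bigcup_{i=1}^s\Lambda_i)=\min\{\lambda\ge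 0:\dim(\lambda K\cap(\Lambda\setminus\bigcup_{i=1}^s\Lambda_i))\ge j\}$ for $1\le j\le\operatorname{rank}\Lambda$. (For sublattices of rank less than $\operatorname{rank}\Lambda$, the condition $\bigcup_i\Lambda_i\ne\Lambda$ holds automatically.) *)

theory Defs
  imports "HOL-Analysis.Analysis"
begin

definition o_symmetric_convex_body :: "'a::euclidean_space set \<Rightarrow> bool" where
  "o_symmetric_convex_body K \<longleftrightarrow> compact K \<and> convex K \<and> uminus ` K = K"

definition int_span :: "'a::real_vector set \<Rightarrow> 'a set" where
  "int_span B = {\<Sum>b\<in>B. of_int (c b) *\<^sub>R b | c :: 'a \<Rightarrow> int. True}"

text \<open>The empty basis is allowed; it generates the trivial lattice of rank 0.\<close>

definition lattice_basis :: "'a::euclidean_space set \<Rightarrow> 'a set \<Rightarrow> bool" where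
  "lattice_basis B L \<longleftrightarrow> independent B \<and> L = int_span B"

definition is_lattice :: "'a::euclidean_space set \<Rightarrow> bool" where
  "is_lattice L \<longleftrightarrow> (\<exists>B. lattice_basis B L)"

definition some_lattice_basis :: "'a::euclidean_space set \<Rightarrow> 'a set" where
  "some_lattice_basis L = (SOME B. lattice_basis B L)"

definition lattice_rank :: "'a::euclidean_space set \<Rightarrow> nat" where
  "lattice_rank L = card (some_lattice_basis L)"

definition fundamental_cell :: "'a::real_vector set \<Rightarrow> 'a set" where
  "fundamental_cell B = {\<Sum>b\<in>B. t b *\<^sub>R b | t :: 'a \<Rightarrow> real. \<forall>b\<in>B. 0 \<le> t b \<and> t b < 1}"

text \<open>The determinant is only meaningful for lattices of full rank: the Lebesgue measure is the
  one of the ambient space, so lattices of smaller rank get the value 0.  For full rank, the value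
  does not depend on the chosen basis, as two bases differ by a unimodular transformation.\<close>

definition lattice_det :: "'a::euclidean_space set \<Rightarrow> real" where
  "lattice_det L = measure lebesgue (fundamental_cell (some_lattice_basis L))"

text \<open>The set \<open>X\<close> is either a lattice or a lattice with finitely many sublattices removed, so this
  covers both the ordinary and the restricted successive minima. Here \<^const>\<open>dim\<close> is the dimension of
  the linear span.\<close>

definition successive_minimum :: "nat \<Rightarrow> 'a::euclidean_space set \<Rightarrow> 'a set \<Rightarrow> real" where
  "successive_minimum j K X = (LEAST r::real. 0 \<le> r \<and> j \<le> dim ((\<lambda>x. r *\<^sub>R x) ` K \<inter> X))"

lemma some_lattice_basis:
  "is_lattice L \<Longrightarrow> lattice_basis (some_lattice_basis L) L"
  unfolding is_lattice_def some_lattice_basis_def by (rule someI_ex)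

lemma lattice_rank_eq_dim:
  assumes "is_lattice L"
  shows "lattice_rank L = dim L"
proof -
  define B where "B = some_lattice_basis L"
  have B: "independent B" "L = int_span B"
    using some_lattice_basis[OF assms] by (auto simp: B_def lattice_basis_def)
  have fin: "finite B"
    using B(1) by (rule independent_imp_finite)
  have "b \<in> L" if "b \<in> B" for b
  proof -
    have "(\<Sum>a\<in>B. of_int (if a = b then 1 else 0) *\<^sub>R a) = (\<Sum>a\<in>B. if a = b then a else 0)"
      by (rule sum.cong) simp_all
    also have "\<dots> = b"
      using that fin by (simp add: sum.delta)
    finally have "b = (\<Sum>a\<in>B. of_int (if a = b then 1 else 0) *\<^sub>R a)"
      by (rule sym)
    then show ?thesis
      unfolding B(2) int_span_def mem_Collect_eq
      by (intro exI[of _ "\<lambda>a. if a = b then 1 else 0"] conjI TrueI)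
  qed
  moreover have "L \<subseteq> span B"
  proof
    fix x assume "x \<in> L"
    then obtain c :: "'a \<Rightarrow> int" where x: "x = (\<Sum>b\<in>B. of_int (c b) *\<^sub>R b)"
      unfolding B(2) int_span_def by blast
    show "x \<in> span B"
      unfolding x by (intro span_sum span_scale span_base)
  qed
  ultimately have "dim L = card B"
    using B(1) by (intro dim_unique[OF _ _ B(1) refl]) auto
  then show ?thesis
    by (simp add: lattice_rank_def B_def)
qed

end

theory Submission
  imports Defs
begin

text \<open>
  Let \<open>t\<close> be the right-hand side of the claim. A symmetric form of Blichfeldt's theorem produces at
  least \<open>2 (t\<^sup>n vol K / (2\<^sup>n det \<Lambda>) - 1)\<close> nonzero points of \<open>\<Lambda>\<close> in a dilate \<open>\<mu> K\<close> with \<open>\<mu> < t\<close>. On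
  the other hand, for a positive integer \<open>q > 2 \<mu> / \<lambda>\<^sub>1(K, \<Lambda>\<^sub>i)\<close> two points of \<open>\<mu> K \<inter> \<Lambda>\<^sub>i\<close> congruent
  modulo \<open>q \<Lambda>\<^sub>i\<close> coincide, so \<open>\<mu> K\<close> contains fewer than \<open>(3 \<mu> / \<lambda>\<^sub>1(K, \<Lambda>\<^sub>i))\<^sup>n\<^sup>-\<^sup>1\<close> nonzero points of
  \<open>\<Lambda>\<^sub>i\<close>, which is at most \<open>3\<^sup>n\<^sup>-\<^sup>1 t\<^sup>n\<^sup>-\<^sup>1 / (\<lambda>\<^sub>1(K, \<Lambda>)\<^sup>n\<^sup>-\<^sup>2 \<lambda>\<^sub>1(K, \<Lambda>\<^sub>i))\<close>. For this \<open>t\<close> the sublattices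
  therefore cannot contain all the points of \<open>\<Lambda>\<close> in \<open>\<mu> K\<close>.
\<close>

section \<open>Lattice operations and integer coordinates\<close>

lemma int_span_zero: "0 \<in> int_span B"
  unfolding int_span_def by (auto intro!: exI[of _ "\<lambda>_. 0"])

lemma int_span_diff: "x \<in> int_span B \<Longrightarrow> y \<in> int_span B \<Longrightarrow> x - y \<in> int_span B"
proof -
  assume "x \<in> int_span B" "y \<in> int_span B"
  then obtain c d :: "'a \<Rightarrow> int" where
    "x = (\<Sum>b\<in>B. of_int (c b) *\<^sub>R b)" "y = (\<Sum>b\<in>B. of_int (d b) *\<^sub>R b)"
    unfolding int_span_def by blast
  then have "x - y = (\<Sum>b\<in>B. of_int (c b - d b) *\<^sub>R b)"
    by (simp add: sum_subtractf scaleR_diff_left)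
  then show ?thesis
    unfolding int_span_def by (auto intro!: exI[of _ "\<lambda>b. c b - d b"])
qed

lemma lattice_zero: "is_lattice L \<Longrightarrow> 0 \<in> L"
  by (auto simp: is_lattice_def lattice_basis_def int_span_zero)

lemma lattice_diff: "is_lattice L \<Longrightarrow> x \<in> L \<Longrightarrow> y \<in> L \<Longrightarrow> x - y \<in> L"
  by (auto simp: is_lattice_def lattice_basis_def int_span_diff)

lemma lattice_nonzero_point:
  assumes "is_lattice L" and "1 \<le> lattice_rank L"
  obtains x where "x \<in> L" "x \<noteq> 0"
proof -
  have "dim L \<noteq> 0"
    using assms lattice_rank_eq_dim by force
  then show ?thesis
    using that by (auto simp: dim_eq_0)
qed

text \<open>Keeping the coefficient set \<open>T\<close> arbitrary lets one linear map describe both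
  the lattice (\<open>T\<close> the integers) and its fundamental cell (\<open>T\<close> the
  half-open unit interval).\<close>

lemma linear_combinations_reindex:
  fixes h :: "'n::finite \<Rightarrow> 'a::real_vector" and T :: "real set"
  assumes "bij_betw h UNIV B"
  shows "{\<Sum>b\<in>B. t b *\<^sub>R b | t. \<forall>b\<in>B. t b \<in> T}
    = (\<lambda>z::real^'n. \<Sum>i\<in>UNIV. z $ i *\<^sub>R h i) ` {z. \<forall>i. z $ i \<in> T}" (is "?L = ?R")
proof
  have inv: "inv_into UNIV h (h i) = i" for i
    using assms by (simp add: bij_betw_def)
  have hB: "h i \<in> B" for i
    using assms by (auto simp: bij_betw_def)
  have sum: "(\<Sum>b\<in>B. t b *\<^sub>R b) = (\<Sum>i\<in>UNIV. t (h i) *\<^sub>R h i)" for t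
    using sum.reindex_bij_betw[OF assms, of "\<lambda>b. t b *\<^sub>R b"] by simp
  show "?L \<subseteq> ?R"
  proof
    fix x assume "x \<in> ?L"
    then obtain t where t: "x = (\<Sum>b\<in>B. t b *\<^sub>R b)" "\<forall>b\<in>B. t b \<in> T"
      by blast
    then show "x \<in> ?R"
      by (intro image_eqI[of _ _ "\<chi> i. t (h i)"]) (auto simp: sum hB)
  qed
  show "?R \<subseteq> ?L"
  proof
    fix x assume "x \<in> ?R"
    then obtain z :: "real^'n" where z: "x = (\<Sum>i\<in>UNIV. z $ i *\<^sub>R h i)" "\<forall>i. z $ i \<in> T"
      by blast
    then have "x = (\<Sum>b\<in>B. (z $ inv_into UNIV h b) *\<^sub>R b)"
      by (simp add: sum inv)
    then show "x \<in> ?L"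
      using z(2) by (intro CollectI exI[of _ "\<lambda>b. z $ inv_into UNIV h b"]) simp
  qed
qed

lemma int_span_altdef: "int_span B = {\<Sum>b\<in>B. t b *\<^sub>R b | t. \<forall>b\<in>B. t b \<in> \<int>}"
proof
  show "int_span B \<subseteq> {\<Sum>b\<in>B. t b *\<^sub>R b | t. \<forall>b\<in>B. t b \<in> \<int>}"
    unfolding int_span_def by (force intro: Ints_of_int)
  show "{\<Sum>b\<in>B. t b *\<^sub>R b | t. \<forall>b\<in>B. t b \<in> \<int>} \<subseteq> int_span B"
  proof
    fix x assume "x \<in> {\<Sum>b\<in>B. t b *\<^sub>R b | t. \<forall>b\<in>B. t b \<in> \<int>}"
    then obtain t where t: "x = (\<Sum>b\<in>B. t b *\<^sub>R b)" "\<forall>b\<in>B. t b \<in> \<int>"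
      by blast
    then have "x = (\<Sum>b\<in>B. of_int \<lfloor>t b\<rfloor> *\<^sub>R b)"
      by (auto intro!: sum.cong)
    then show "x \<in> int_span B"
      unfolding int_span_def by (auto intro!: exI[of _ "\<lambda>b. \<lfloor>t b\<rfloor>"])
  qed
qed

text \<open>The linear map sending the standard basis to a lattice basis is injective by
  independence. It reduces questions about the lattice and its cell to integer vectors and the
  half-open unit cube.\<close>

lemma full_rank_lattice_coordinates:
  fixes L :: "(real^'n) set"
  assumes "is_lattice L" and "lattice_rank L = CARD('n)"
  obtains f :: "real^'n \<Rightarrow> real^'n" where "linear f" "inj f" "L = f ` {z. \<forall>i. z $ i \<in> \<int>}"
    "fundamental_cell (some_lattice_basis L) = f ` {z. \<forall>i. z $ i \<in> {0..<1}}"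
proof -
  define B where "B = some_lattice_basis L"
  have B: "independent B" "L = int_span B"
    using some_lattice_basis[OF assms(1)] by (auto simp: B_def lattice_basis_def)
  have fin: "finite B"
    using B(1) by (rule independent_imp_finite)
  have "card B = CARD('n)"
    using assms(2) by (simp add: B_def lattice_rank_def)
  then obtain h :: "'n \<Rightarrow> real^'n" where h: "bij_betw h UNIV B"
    using fin by (metis finite_class.finite_UNIV finite_same_card_bij)
  define f :: "real^'n \<Rightarrow> real^'n" where "f = (\<lambda>z. \<Sum>i\<in>UNIV. z $ i *\<^sub>R h i)"
  have lin: "linear f"
    unfolding f_def
    by (intro linear_compose_sum ballI linearI) (auto simp: scaleR_add_left)
  have "z = 0" if "f z = 0" for z
  proof -
    have inv: "inv_into UNIV h (h i) = i" for i
      using h by (simp add: bij_betw_def)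
    have "(\<Sum>b\<in>B. (z $ inv_into UNIV h b) *\<^sub>R b) = f z"
      using sum.reindex_bij_betw[OF h, of "\<lambda>b. (z $ inv_into UNIV h b) *\<^sub>R b"]
      by (simp add: inv f_def)
    then have "z $ inv_into UNIV h b = 0" if "b \<in> B" for b
      using independentD[OF B(1) fin order.refl _ that, of "\<lambda>b. z $ inv_into UNIV h b"]
        \<open>f z = 0\<close> by simp
    then show "z = 0"
      using h inv by (metis bij_betwE iso_tuple_UNIV_I vec_eq_iff zero_index)
  qed
  then have "inj f"
    using lin linear_injective_0 by blast
  moreover have "L = f ` {z. \<forall>i. z $ i \<in> \<int>}"
    unfolding B(2) int_span_altdef f_def by (rule linear_combinations_reindex[OF h])
  moreover have "fundamental_cell B = f ` {z. \<forall>i. z $ i \<in> {0..<1}}"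
    using linear_combinations_reindex[OF h, of "{0..<1}"]
    by (simp add: fundamental_cell_def f_def)
  ultimately show ?thesis
    using lin that B_def by blast
qed

section \<open>Finiteness in bounded sets and measure of the fundamental cell\<close>

lemma finite_bounded_integer_points:
  "finite {z :: real^'n. (\<forall>i. z $ i \<in> \<int>) \<and> norm z \<le> R}"
proof (rule finite_subset)
  let ?P = "PiE UNIV (\<lambda>_::'n. {- \<lfloor>R\<rfloor>..\<lfloor>R\<rfloor>})"
  show "finite ((\<lambda>h. (\<chi> i. of_int (h i)) :: real^'n) ` ?P)"
    by (intro finite_imageI finite_PiE) auto
  show "{z :: real^'n. (\<forall>i. z $ i \<in> \<int>) \<and> norm z \<le> R} \<subseteq> (\<lambda>h. \<chi> i. of_int (h i)) ` ?P"
  proof clarify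
    fix z :: "real^'n" assume z: "\<forall>i. z $ i \<in> \<int>" "norm z \<le> R"
    show "z \<in> (\<lambda>h. \<chi> i. of_int (h i)) ` ?P"
    proof (rule image_eqI)
      show "z = (\<chi> i. of_int \<lfloor>z $ i\<rfloor>)"
        using z(1) by (simp add: vec_eq_iff)
      have "\<bar>z $ i\<bar> \<le> R" for i
        using component_le_norm_cart[of z i] z(2) by simp
      moreover have "of_int \<lfloor>z $ i\<rfloor> = z $ i" for i
        using z(1) by simp
      ultimately show "(\<lambda>i. \<lfloor>z $ i\<rfloor>) \<in> ?P"
        by (auto simp: PiE_def abs_le_iff floor_mono) (smt (verit) floor_mono le_floor_iff of_int_minus)
    qed
  qed
qed

text \<open>A linear left inverse of the coordinate map keeps bounded sets bounded and sends lattice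
  points back to integer vectors.\<close>

lemma finite_lattice_Int_bounded:
  fixes L :: "(real^'n) set"
  assumes "is_lattice L" and "lattice_rank L = CARD('n)" and "bounded S"
  shows "finite (L \<inter> S)"
proof -
  obtain f :: "real^'n \<Rightarrow> real^'n" where f: "linear f" "inj f" "L = f ` {z. \<forall>i. z $ i \<in> \<int>}"
    "fundamental_cell (some_lattice_basis L) = f ` {z. \<forall>i. z $ i \<in> {0..<1}}"
    by (rule full_rank_lattice_coordinates[OF assms(1,2)])
  obtain g where g: "linear g" "g \<circ> f = id"
    using linear_injective_left_inverse[OF f(1,2)] by blast
  then have gf: "g (f z) = z" for z
    by (metis comp_apply id_apply)
  have "bounded (g ` S)"
    using g(1) assms(3) bounded_linear_image linear_conv_bounded_linear by blast
  then obtain R where R: "\<And>x. x \<in> S \<Longrightarrow> norm (g x) \<le> R"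
    unfolding bounded_iff by blast
  have "L \<inter> S \<subseteq> f ` {z. (\<forall>i. z $ i \<in> \<int>) \<and> norm z \<le> R}"
    using R by (force simp: f(3) gf)
  then show ?thesis
    using finite_bounded_integer_points finite_surj by blast
qed

text \<open>The cell is a bounded linear image of the half-open cube. It is Borel as a finite
  intersection of open and closed sets, and it contains the image of the open cube, a nonempty open
  set, so its measure is positive.\<close>

lemma fundamental_cell_lmeasurable_det_pos:
  fixes L :: "(real^'n) set"
  assumes "is_lattice L" and "lattice_rank L = CARD('n)"
  shows "fundamental_cell (some_lattice_basis L) \<in> lmeasurable" and "0 < lattice_det L"
    and "bounded (fundamental_cell (some_lattice_basis L))"
proof -
  obtain f :: "real^'n \<Rightarrow> real^'n" where f: "linear f" "inj f" "L = f ` {z. \<forall>i. z $ i \<in> \<int>}"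
    "fundamental_cell (some_lattice_basis L) = f ` {z. \<forall>i. z $ i \<in> {0..<1}}"
    by (rule full_rank_lattice_coordinates[OF assms])
  define F where "F = fundamental_cell (some_lattice_basis L)"
  obtain g where g: "linear g" "g \<circ> f = id"
    using linear_injective_left_inverse[OF f(1,2)] by blast
  then have gf: "g (f z) = z" for z
    by (metis comp_apply id_apply)
  have surj: "surj f"
    using linear_injective_imp_surjective[OF f(1,2)] by simp
  have F: "F = (\<Inter>i\<in>UNIV. {x. 0 \<le> g x $ i} \<inter> {x. g x $ i < 1})"
  proof (rule set_eqI)
    fix x
    obtain z where "x = f z"
      using surj by blast
    then show "x \<in> F \<longleftrightarrow> x \<in> (\<Inter>i\<in>UNIV. {x. 0 \<le> g x $ i} \<inter> {x. g x $ i < 1})"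
      using f(2) by (auto simp: F_def f(4) gf inj_image_mem_iff)
  qed
  have cont: "continuous_on UNIV (\<lambda>x. g x $ i)" for i
    using g(1) by (intro continuous_on_component linear_continuous_on)
      (simp add: linear_conv_bounded_linear)
  have "{x. 0 \<le> g x $ i} \<inter> {x. g x $ i < 1} \<in> sets borel" for i
    using closed_Collect_le[OF continuous_on_const cont] open_Collect_less[OF cont continuous_on_const]
    by (intro sets.Int) (auto intro: borel_closed borel_open)
  then have "F \<in> sets borel"
    unfolding F by (metis (no_types, lifting) finite_class.finite_UNIV sets.finite_INT UNIV_not_empty)
  moreover have "{z :: real^'n. \<forall>i. z $ i \<in> {0..<1}} \<subseteq> cbox 0 1"
    by (auto simp: mem_box_cart less_imp_le)
  then have "bounded {z :: real^'n. \<forall>i. z $ i \<in> {0..<1}}"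
    using bounded_cbox bounded_subset by blast
  then have "bounded F"
    using f(1) bounded_linear_image linear_conv_bounded_linear unfolding f(4) F_def by blast
  ultimately have "F \<in> lmeasurable"
    by (intro bounded_set_imp_lmeasurable) auto
  have "box 0 1 \<subseteq> {z :: real^'n. \<forall>i. z $ i \<in> {0..<1}}"
    by (auto simp: mem_box_cart less_imp_le)
  then have "f ` box 0 1 \<subseteq> F"
    unfolding f(4) F_def by (rule image_mono)
  moreover have "open (f ` box 0 1)"
    using open_surjective_linear_image[OF open_box f(1) surj] .
  moreover have "f ` box 0 (1::real^'n) \<noteq> {}"
    using interval_ne_empty_cart(2)[of 0 "1::real^'n"] by simp
  ultimately have "measure lebesgue F \<noteq> 0"
    using \<open>F \<in> lmeasurable\<close> open_not_negligible negligible_subset[of F]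
    by (metis negligible_iff_measure)
  then show "0 < lattice_det L"
    by (simp add: lattice_det_def F_def zero_less_measure_iff)
  show "fundamental_cell (some_lattice_basis L) \<in> lmeasurable"
    "bounded (fundamental_cell (some_lattice_basis L))"
    using \<open>F \<in> lmeasurable\<close> \<open>bounded F\<close> by (simp_all add: F_def)
qed

section \<open>Blichfeldt's theorem and its symmetric form\<close>

lemma fundamental_cell_covers:
  fixes L :: "(real^'n) set"
  assumes "is_lattice L" and "lattice_rank L = CARD('n)"
  obtains v y where "v \<in> L" "y \<in> fundamental_cell (some_lattice_basis L)" "x = v + y"
proof -
  obtain f :: "real^'n \<Rightarrow> real^'n" where f: "linear f" "inj f" "L = f ` {z. \<forall>i. z $ i \<in> \<int>}"
    "fundamental_cell (some_lattice_basis L) = f ` {z. \<forall>i. z $ i \<in> {0..<1}}"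
    by (rule full_rank_lattice_coordinates[OF assms])
  obtain z where z: "x = f z"
    using linear_injective_imp_surjective[OF f(1,2)] by blast
  \<comment> \<open>Integer parts of the coordinates give the lattice vector, fractional parts the
    point of the cell.\<close>
  define u w :: "real^'n" where "u = (\<chi> i. of_int \<lfloor>z $ i\<rfloor>)" and "w = (\<chi> i. frac (z $ i))"
  have "z = u + w"
    by (simp add: u_def w_def vec_eq_iff frac_def)
  then have "x = f u + f w"
    using f(1) z linear_add by blast
  moreover have "f u \<in> L"
    by (auto simp: f(3) u_def)
  moreover have "f w \<in> fundamental_cell (some_lattice_basis L)"
    by (auto simp: f(4) w_def frac_lt_1)
  ultimately show ?thesis
    using that by blast
qed

text \<open>Averaging: cut \<open>S\<close> along the translates of the cell and move all pieces
  back into the cell. Their total measure exceeds \<open>m\<close> times that of the cell, so some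
  point \<open>y\<close> lies in more than \<open>m\<close> pieces; moving \<open>y\<close> back
  into each of them gives points of \<open>S\<close> that differ by lattice vectors.\<close>

lemma blichfeldt:
  fixes L S :: "(real^'n) set"
  assumes L: "is_lattice L" "lattice_rank L = CARD('n)"
    and S: "bounded S" "S \<in> lmeasurable" and m: "of_nat m * lattice_det L < measure lebesgue S"
  obtains P where "P \<subseteq> S" "finite P" "card P = Suc m" "\<And>x y. x \<in> P \<Longrightarrow> y \<in> P \<Longrightarrow> x - y \<in> L"
proof -
  define F where "F = fundamental_cell (some_lattice_basis L)"
  note F = fundamental_cell_lmeasurable_det_pos[OF L, folded F_def]
  \<comment> \<open>Only these finitely many lattice vectors \<open>v\<close> can have a translate
    \<open>v + F\<close> that meets \<open>S\<close>.\<close>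
  define T where "T = L \<inter> (\<lambda>(x, y). x - y) ` (S \<times> F)"
  have T: "finite T"
    unfolding T_def using L S(1) F(3) using bounded_minus[OF S(1) F(3)]
    by (intro finite_lattice_Int_bounded) auto
  define A where "A v = F \<inter> (\<lambda>x. x - v) ` S" for v
  have A: "A v \<in> lmeasurable" for v
    using F(1) S(2) measurable_translation_subtract by (auto simp: A_def)
  have int: "integrable lebesgue (indicator (A v) :: _ \<Rightarrow> real)" for v
    using A[of v] by (intro integrable_real_indicator) (auto simp: fmeasurable_def)
  have "S \<subseteq> (\<Union>v\<in>T. (+) v ` A v)"
  proof
    fix x assume "x \<in> S"
    obtain v y where *: "v \<in> L" "y \<in> F" "x = v + y"
      unfolding F_def by (rule fundamental_cell_covers[OF L])
    with \<open>x \<in> S\<close> have "y \<in> A v"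
      by (force simp: A_def)
    moreover have "v \<in> T"
      using * \<open>x \<in> S\<close> by (force simp: T_def)
    ultimately show "x \<in> (\<Union>v\<in>T. (+) v ` A v)"
      using * by blast
  qed
  then have "measure lebesgue S \<le> measure lebesgue (\<Union>v\<in>T. (+) v ` A v)"
    using S(2) A T by (intro measure_mono_fmeasurable fmeasurable.finite_UN)
      (auto intro: measurable_translation)
  also have "\<dots> \<le> (\<Sum>v\<in>T. measure lebesgue ((+) v ` A v))"
    using A T by (intro measure_UNION_le) (auto intro!: fmeasurableD measurable_translation)
  also have "\<dots> = (\<Sum>v\<in>T. measure lebesgue (A v))"
    by (simp add: measure_translation)
  also have "\<dots> = (\<Sum>v\<in>T. integral\<^sup>L lebesgue (indicator (A v)))"
    using A by simp
  also have "\<dots> = integral\<^sup>L lebesgue (\<lambda>y. \<Sum>v\<in>T. indicator (A v) y)"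
    by (rule Bochner_Integration.integral_sum[symmetric]) (rule int)
  finally have le: "measure lebesgue S \<le> integral\<^sup>L lebesgue (\<lambda>y. \<Sum>v\<in>T. indicator (A v) y)" .
  have count: "(\<Sum>v\<in>T. indicator (A v) y) = real (card {v\<in>T. y \<in> A v})" for y
    using sum.inter_filter[OF T, of "\<lambda>_. 1::real" "\<lambda>v. y \<in> A v"]
    by (simp add: indicator_def of_bool_def)
  have "\<exists>y. m < card {v\<in>T. y \<in> A v}"
  proof (rule ccontr)
    assume "\<not> ?thesis"
    then have c: "card {v\<in>T. y \<in> A v} \<le> m" for y
      by (simp add: not_less)
    \<comment> \<open>Every piece \<open>A v\<close> lies in \<open>F\<close>, so the count vanishes
      off \<open>F\<close> and its integral is at most \<open>m\<close> times the measure of the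
      cell.\<close>
    have "(\<Sum>v\<in>T. indicator (A v) y) \<le> real m * indicator F y" for y
      unfolding count using c[of y] by (auto simp: indicator_def A_def)
    then have "integral\<^sup>L lebesgue (\<lambda>y. \<Sum>v\<in>T. indicator (A v) y) \<le> integral\<^sup>L lebesgue (\<lambda>y. real m * indicator F y)"
      using F(1) by (intro integral_mono Bochner_Integration.integrable_sum integrable_mult_right int
          integrable_real_indicator) (auto simp: fmeasurable_def)
    also have "\<dots> = real m * lattice_det L"
      using F(1) by (simp add: lattice_det_def F_def)
    finally show False
      using le m by linarith
  qed
  then obtain y where "Suc m \<le> card {v\<in>T. y \<in> A v}"
    by (auto simp: Suc_le_eq)
  then obtain V where V: "V \<subseteq> {v\<in>T. y \<in> A v}" "card V = Suc m" "finite V"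
    using obtain_subset_with_card_n by blast
  show ?thesis
  proof
    show "(+) y ` V \<subseteq> S"
      using V(1) by (auto simp: A_def)
    show "finite ((+) y ` V)" "card ((+) y ` V) = Suc m"
      using V by (auto simp: card_image)
    show "a - b \<in> L" if ab: "a \<in> (+) y ` V" "b \<in> (+) y ` V" for a b
    proof -
      obtain v w where "v \<in> V" "a = y + v" "w \<in> V" "b = y + w"
        using ab by blast
      then show ?thesis
        using V(1) lattice_diff[OF L(1), of v w] by (auto simp: T_def)
    qed
  qed
qed

text \<open>Subtracting a point \<open>p\<close> of maximal norm from the other \<open>m\<close>
  points given by \<open>blichfeldt\<close> yields \<open>m\<close> nonzero lattice vectors, no two
  of them opposite and none its own negative. Adding the negatives therefore doubles the
  count.\<close>

lemma blichfeldt_symmetric: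
  fixes L S :: "(real^'n) set"
  assumes L: "is_lattice L" "lattice_rank L = CARD('n)"
    and S: "bounded S" "S \<in> lmeasurable" and m: "of_nat m * lattice_det L < measure lebesgue S"
  obtains D where "D \<subseteq> L \<inter> {x - y | x y. x \<in> S \<and> y \<in> S} - {0}" "finite D" "card D = 2 * m"
proof -
  obtain P where P: "P \<subseteq> S" "finite P" "card P = Suc m" "\<And>x y. x \<in> P \<Longrightarrow> y \<in> P \<Longrightarrow> x - y \<in> L"
    using blichfeldt[OF assms] by metis
  then have "P \<noteq> {}"
    by auto
  then have "Max (norm ` P) \<in> norm ` P"
    using P(2) by (intro Max_in) auto
  then obtain p where "p \<in> P" "norm p = Max (norm ` P)"
    by force
  then have p: "p \<in> P" "\<And>x. x \<in> P \<Longrightarrow> norm x \<le> norm p"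
    using P(2) by simp_all
  define E where "E = (\<lambda>x. x - p) ` (P - {p})"
  have E: "finite E" "card E = m"
    using P(2,3) p(1) by (auto simp: E_def card_image inj_on_def)
  \<comment> \<open>If both \<open>p + d\<close> and \<open>p - d\<close> were in \<open>P\<close>, then by the parallelogram law \<open>p\<close> would not have
    maximal norm.\<close>
  have disj: "E \<inter> uminus ` E = {}"
  proof (rule ccontr)
    assume "E \<inter> uminus ` E \<noteq> {}"
    then obtain x y where xy: "x \<in> P" "y \<in> P" "x \<noteq> p" "x - p = - (y - p)"
      unfolding E_def by blast
    define d where "d = x - p"
    have "x = p + d" "y = p - d" "d \<noteq> 0"
      using xy by (auto simp: d_def algebra_simps)
    then have "norm (p + d) ^ 2 \<le> norm p ^ 2" "norm (p - d) ^ 2 \<le> norm p ^ 2" "d \<bullet> d > 0"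
      using xy p(2) by (auto intro!: power_mono)
    then show False
      by (simp add: power2_norm_eq_inner inner_add_left inner_add_right inner_diff_left
          inner_diff_right inner_commute)
  qed
  show ?thesis
  proof
    show "E \<union> uminus ` E \<subseteq> L \<inter> {x - y | x y. x \<in> S \<and> y \<in> S} - {0}"
      using P(1,4) p(1) by (fastforce simp: E_def)
    show "finite (E \<union> uminus ` E)"
      using E by simp
    show "card (E \<union> uminus ` E) = 2 * m"
      using E disj by (simp add: card_Un_disjoint card_image)
  qed
qed

section \<open>Dilates of symmetric convex bodies\<close>

lemma zero_in_symmetric_convex_body:
  assumes "o_symmetric_convex_body K" and "K \<noteq> {}"
  shows "0 \<in> K"
proof -
  obtain x where "x \<in> K"
    using assms(2) by blast
  then have "- x \<in> K"
    using assms(1) by (auto simp: o_symmetric_convex_body_def)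
  then have "(1/2) *\<^sub>R x + (1/2) *\<^sub>R (- x) \<in> K"
    using assms(1) \<open>x \<in> K\<close> by (intro convexD) (auto simp: o_symmetric_convex_body_def)
  then show ?thesis
    by simp
qed

lemma symmetric_convex_body_scale_mono:
  assumes "o_symmetric_convex_body K" and "0 \<le> r" and "r \<le> t"
  shows "(\<lambda>x. r *\<^sub>R x) ` K \<subseteq> (\<lambda>x. t *\<^sub>R x) ` K"
proof (cases "t = 0")
  case True
  then show ?thesis
    using assms by auto
next
  case False
  show ?thesis
  proof
    fix y assume "y \<in> (\<lambda>x. r *\<^sub>R x) ` K"
    then obtain k where k: "k \<in> K" "y = r *\<^sub>R k"
      by blast
    have "convex K" "0 \<in> K"
      using assms(1) k(1) zero_in_symmetric_convex_body by (auto simp: o_symmetric_convex_body_def)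
    then have "(r / t) *\<^sub>R k + (1 - r / t) *\<^sub>R 0 \<in> K"
      using k(1) False assms by (intro convexD) (auto simp: divide_le_eq)
    then show "y \<in> (\<lambda>x. t *\<^sub>R x) ` K"
      using False k(2) by (intro image_eqI[of _ _ "(r / t) *\<^sub>R k"]) auto
  qed
qed

text \<open>With \<open>x = t k\<close> and \<open>y = t l\<close>, the difference is
  \<open>2 t\<close> times the midpoint of \<open>k\<close> and \<open>- l\<close>, which lies in
  \<open>K\<close> by symmetry and convexity.\<close>

lemma symmetric_convex_body_diff:
  assumes K: "o_symmetric_convex_body K" and "0 \<le> t"
    and "x \<in> (\<lambda>x. t *\<^sub>R x) ` K" and "y \<in> (\<lambda>x. t *\<^sub>R x) ` K"
  shows "x - y \<in> (\<lambda>x. (2 * t) *\<^sub>R x) ` K"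
proof -
  obtain k l where k: "k \<in> K" "l \<in> K" "x = t *\<^sub>R k" "y = t *\<^sub>R l"
    using assms(3,4) by blast
  then have "- l \<in> K"
    using K by (auto simp: o_symmetric_convex_body_def)
  then have "(1/2) *\<^sub>R k + (1/2) *\<^sub>R (- l) \<in> K"
    using K k(1) by (intro convexD) (auto simp: o_symmetric_convex_body_def)
  then show ?thesis
    using k by (intro image_eqI[of _ _ "(1/2) *\<^sub>R k + (1/2) *\<^sub>R (- l)"])
      (auto simp: algebra_simps)
qed

text \<open>The interior ball need not be centred at the origin. Half the difference of
  \<open>a + t x\<close> and \<open>a - t x\<close> is \<open>t x\<close>, which removes the centre
  \<open>a\<close>.\<close>

lemma symmetric_convex_body_absorbs:
  fixes K :: "'a::euclidean_space set"
  assumes "o_symmetric_convex_body K" and "interior K \<noteq> {}"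
  obtains r where "0 < r" "x \<in> (\<lambda>x. r *\<^sub>R x) ` K"
proof -
  obtain a e where "0 < e" "ball a e \<subseteq> K"
    using assms(2) by (meson all_not_in_conv mem_interior)
  \<comment> \<open>The summand 1 keeps the denominator positive when \<open>x = 0\<close>; the
    factor 1/2 covers the case distinction-free bound \<open>t * norm x < e\<close>.\<close>
  define t where "t = e / (norm x + 1) / 2"
  have t: "0 < t" "t * norm x < e"
    using \<open>0 < e\<close> by (auto simp: t_def field_simps add_pos_nonneg)
      (smt (verit) mult_nonneg_nonneg norm_ge_zero)
  then have "a + t *\<^sub>R x \<in> K" "a - t *\<^sub>R x \<in> K"
    using \<open>ball a e \<subseteq> K\<close> by (auto simp: dist_norm subset_iff)
  then have "(a + t *\<^sub>R x) - (a - t *\<^sub>R x) \<in> (\<lambda>x. (2 * 1) *\<^sub>R x) ` K"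
    by (intro symmetric_convex_body_diff[OF assms(1)]) auto
  moreover have "(a + u) - (a - u) = 2 *\<^sub>R u" for u
    by (simp add: scaleR_2)
  ultimately obtain k where "k \<in> K" "2 *\<^sub>R (t *\<^sub>R x) = 2 *\<^sub>R k"
    by (metis imageE mult.right_neutral)
  then have "t *\<^sub>R x \<in> K"
    by (simp del: scaleR_scaleR)
  then show ?thesis
    using t(1) by (intro that[of "1 / t"]) (auto intro!: image_eqI[of _ _ "t *\<^sub>R x"])
qed

section \<open>Attainment of the first successive minimum\<close>

lemma one_le_dim_iff: "1 \<le> dim X \<longleftrightarrow> (\<exists>x\<in>X. x \<noteq> (0::'a::euclidean_space))"
  by (metis dim_eq_0 insertI1 less_one not_less singletonD subsetI subset_eq)

text \<open>\<open>LEAST\<close> over the reals carries information only once a minimum is known to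
  exist; compactness of \<open>K\<close> and finiteness of lattice points in a dilate provide it.
  Since \<open>X\<close> is any subset of the lattice with a nonzero point, the result serves the
  full lattice, the sublattices and the restricted minimum alike.\<close>

lemma successive_minimum_one:
  fixes K :: "(real^'n) set"
  assumes K: "o_symmetric_convex_body K" "interior K \<noteq> {}"
    and L: "is_lattice L" "lattice_rank L = CARD('n)"
    and X: "X \<subseteq> L" "x \<in> X" "x \<noteq> 0"
  shows "0 < successive_minimum 1 K X"
    and "\<exists>y\<in>X. y \<noteq> 0 \<and> y \<in> (\<lambda>x. successive_minimum 1 K X *\<^sub>R x) ` K"
    and "\<And>r y. \<lbrakk>0 \<le> r; y \<in> X; y \<noteq> 0; y \<in> (\<lambda>x. r *\<^sub>R x) ` K\<rbrakk> \<Longrightarrow> successive_minimum 1 K X \<le> r"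
proof -
  define A where "A = {r. 0 \<le> r \<and> (\<exists>y\<in>X. y \<noteq> 0 \<and> y \<in> (\<lambda>x. r *\<^sub>R x) ` K)}"
  have sm: "successive_minimum 1 K X = (LEAST r. r \<in> A)"
    unfolding successive_minimum_def one_le_dim_iff A_def by (rule arg_cong[where f = Least]) auto
  obtain R where R: "0 < R" "x \<in> (\<lambda>x. R *\<^sub>R x) ` K"
    using symmetric_convex_body_absorbs[OF K] by blast
  have "compact K"
    using K by (simp add: o_symmetric_convex_body_def)
  define P where "P = X \<inter> (\<lambda>x. R *\<^sub>R x) ` K - {0}"
  have "bounded ((\<lambda>x. R *\<^sub>R x) ` K)"
    using \<open>compact K\<close> compact_imp_bounded compact_scaling by blast
  then have "finite (L \<inter> (\<lambda>x. R *\<^sub>R x) ` K)"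
    using finite_lattice_Int_bounded[OF L] by blast
  then have "finite P"
    by (rule rev_finite_subset) (use X(1) in \<open>auto simp: P_def\<close>)
  \<comment> \<open>Pairs of a factor \<open>r\<close> and a point \<open>k\<close> of
    \<open>K\<close> such that \<open>r k\<close> is one of the finitely many candidates in
    \<open>P\<close>. The set is compact, and its first projection is the set of admissible factors
    up to \<open>R\<close>, so the infimum is attained.\<close>
  define C where "C = ({0..R} \<times> K) \<inter> (\<lambda>(r, k). r *\<^sub>R k) -` P"
  have "continuous_on ({0..R} \<times> K) (\<lambda>(r, k). r *\<^sub>R k)"
    by (auto simp: case_prod_unfold intro!: continuous_intros)
  then have "closed C"
    unfolding C_def using \<open>finite P\<close> \<open>compact K\<close>
    by (intro continuous_closed_preimage closed_Times) (auto intro: compact_imp_closed finite_imp_closed)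
  then have "compact C"
    using \<open>compact K\<close> compact_Int_closed[OF compact_Times[of "{0..R}" K], of C]
    by (simp add: C_def Int_assoc[symmetric])
  then have cpt: "compact (fst ` C)"
    by (intro compact_continuous_image continuous_intros)
  have fstC: "fst ` C = A \<inter> {..R}"
  proof
    show "fst ` C \<subseteq> A \<inter> {..R}"
    proof
      fix r assume "r \<in> fst ` C"
      then obtain k where k: "0 \<le> r" "r \<le> R" "k \<in> K" "r *\<^sub>R k \<in> X" "r *\<^sub>R k \<noteq> 0"
        unfolding C_def P_def by fastforce
      then show "r \<in> A \<inter> {..R}"
        unfolding A_def by blast
    qed
    show "A \<inter> {..R} \<subseteq> fst ` C"
    proof
      fix r assume r: "r \<in> A \<inter> {..R}"
      then obtain k where k: "k \<in> K" "r *\<^sub>R k \<in> X" "r *\<^sub>R k \<noteq> 0" "0 \<le> r" "r \<le> R"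
        by (auto simp: A_def)
      then have "r *\<^sub>R k \<in> (\<lambda>x. R *\<^sub>R x) ` K"
        using symmetric_convex_body_scale_mono[OF K(1) k(4,5)] by blast
      then have "(r, k) \<in> C"
        using k by (auto simp: C_def P_def)
      then show "r \<in> fst ` C"
        by force
    qed
  qed
  have "R \<in> A"
    using R X by (auto simp: A_def)
  then have "fst ` C \<noteq> {}"
    by (auto simp: fstC)
  then obtain r where r: "r \<in> fst ` C" "\<And>t. t \<in> fst ` C \<Longrightarrow> r \<le> t"
    using compact_attains_inf[OF cpt] by blast
  then have "r \<in> A" "r \<le> R"
    by (auto simp: fstC)
  have least: "r \<le> t" if "t \<in> A" for t
    using that r(2)[of t] \<open>r \<le> R\<close> by (cases "t \<le> R") (auto simp: fstC)
  then have eq: "successive_minimum 1 K X = r"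
    unfolding sm using \<open>r \<in> A\<close> by (intro Least_equality) auto
  show "\<exists>y\<in>X. y \<noteq> 0 \<and> y \<in> (\<lambda>x. successive_minimum 1 K X *\<^sub>R x) ` K"
    using \<open>r \<in> A\<close> unfolding eq A_def by blast
  show "0 < successive_minimum 1 K X"
    using \<open>r \<in> A\<close> unfolding eq A_def by (cases "r = 0") auto
  show "successive_minimum 1 K X \<le> t" if "0 \<le> t" "y \<in> X" "y \<noteq> 0" "y \<in> (\<lambda>x. t *\<^sub>R x) ` K" for t y
    using least[of t] that unfolding eq A_def by blast
qed

section \<open>Upper bound for lattice points in a dilate\<close>

text \<open>Two points of the lattice in the same residue class modulo \<open>q\<close> differ by \<open>q\<close> times a lattice
  point.\<close>

lemma card_lattice_points_le:
  assumes M: "is_lattice M" and "P \<subseteq> M" and "0 < q"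
    and sep: "\<And>x y z. \<lbrakk>x \<in> P; y \<in> P; z \<in> M; x - y = real q *\<^sub>R z\<rbrakk> \<Longrightarrow> z = 0"
  shows "finite P" and "card P \<le> q ^ lattice_rank M"
proof -
  define B where "B = some_lattice_basis M"
  have B: "independent B" "M = int_span B"
    using some_lattice_basis[OF M] by (auto simp: B_def lattice_basis_def)
  have fin: "finite B"
    using B(1) by (rule independent_imp_finite)
  have "\<forall>x\<in>P. \<exists>c :: 'a \<Rightarrow> int. x = (\<Sum>b\<in>B. of_int (c b) *\<^sub>R b)"
    using assms(2) unfolding B(2) int_span_def by blast
  then obtain c :: "'a \<Rightarrow> 'a \<Rightarrow> int" where c: "\<And>x. x \<in> P \<Longrightarrow> x = (\<Sum>b\<in>B. of_int (c x b) *\<^sub>R b)"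
    by metis
  \<comment> \<open>The residue vector of the coordinates modulo \<open>q\<close> takes at most
    \<open>q\<close> to the power of the rank many values; separation makes it injective on
    \<open>P\<close>.\<close>
  define g where "g x = (\<lambda>b\<in>B. c x b mod int q)" for x
  let ?R = "PiE B (\<lambda>_. {0..<int q})"
  have R: "finite ?R" "card ?R = q ^ lattice_rank M"
    using fin by (auto simp: card_PiE lattice_rank_def B_def intro!: finite_PiE)
  have sub: "g ` P \<subseteq> ?R"
    using \<open>0 < q\<close> by (auto simp: g_def)
  have inj: "inj_on g P"
  proof (rule inj_onI)
    fix x y assume xy: "x \<in> P" "y \<in> P" "g x = g y"
    have "c x b - c y b = int q * ((c x b - c y b) div int q)" if "b \<in> B" for b
    proof -
      have "c x b mod int q = c y b mod int q"
        using fun_cong[OF xy(3), of b] that by (simp add: g_def)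
      then have "int q dvd c x b - c y b"
        by (simp add: mod_eq_dvd_iff)
      then show ?thesis
        by simp
    qed
    then have eq: "real_of_int (c x b - c y b) = real q * real_of_int ((c x b - c y b) div int q)" if "b \<in> B" for b
      using that by (metis of_int_mult of_int_of_nat_eq)
    define z where "z = (\<Sum>b\<in>B. of_int ((c x b - c y b) div int q) *\<^sub>R b)"
    have "x - y = (\<Sum>b\<in>B. real_of_int (c x b - c y b) *\<^sub>R b)"
      by (subst c[OF xy(1)], subst c[OF xy(2)]) (simp add: sum_subtractf scaleR_diff_left)
    also have "\<dots> = real q *\<^sub>R z"
      unfolding z_def scaleR_sum_right scaleR_scaleR by (rule sum.cong) (simp_all only: eq)
    finally have "x - y = real q *\<^sub>R z" .
    moreover have "z \<in> M"
      unfolding B(2) int_span_def z_def by (auto intro!: exI[of _ "\<lambda>b. (c x b - c y b) div int q"])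
    ultimately show "x = y"
      using sep[OF xy(1,2), of z] by simp
  qed
  show "finite P"
    using inj sub R(1) inj_on_finite by blast
  show "card P \<le> q ^ lattice_rank M"
    using card_inj_on_le[OF inj sub R(1)] R(2) by simp
qed

text \<open>If two points of \<open>\<mu> K\<close> differ by \<open>q z\<close> with
  \<open>z\<close> a nonzero point of \<open>M\<close>, then \<open>q z\<close> lies in
  \<open>2 \<mu> K\<close>, so the first minimum of \<open>M\<close> is at most
  \<open>2 \<mu> / q\<close>. A larger \<open>q\<close> rules this out, and points are counted by
  residues modulo \<open>q\<close>.\<close>

lemma card_lattice_points_in_body:
  fixes K M :: "(real^'n) set"
  assumes K: "o_symmetric_convex_body K" "interior K \<noteq> {}"
    and L: "is_lattice L" "lattice_rank L = CARD('n)"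
    and M: "is_lattice M" "M \<subseteq> L" "1 \<le> lattice_rank M" "lattice_rank M \<le> r" and "0 < \<mu>"
  shows "real (card (M \<inter> (\<lambda>x. \<mu> *\<^sub>R x) ` K - {0})) < (3 * \<mu> / successive_minimum 1 K M) ^ r"
proof -
  obtain x where x: "x \<in> M" "x \<noteq> 0"
    using lattice_nonzero_point[OF M(1,3)] .
  define l where "l = successive_minimum 1 K M"
  note sm = successive_minimum_one[OF K L M(2) x, folded l_def]
  define P where "P = M \<inter> (\<lambda>x. \<mu> *\<^sub>R x) ` K"
  have "K \<noteq> {}"
    using K(2) by auto
  show ?thesis
  proof (cases "\<mu> < l")
    case True
    then have "P - {0} = {}"
      using sm(3)[of \<mu>] \<open>0 < \<mu>\<close> by (auto simp: P_def)
    then have "card (P - {0}) = 0"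
      by (simp only: card.empty)
    then show ?thesis
      using sm(1) \<open>0 < \<mu>\<close> unfolding P_def[symmetric] l_def[symmetric] by simp
  next
    case False
    \<comment> \<open>The least integer strictly above \<open>2 \<mu> / l\<close>. It is at most
      \<open>2 \<mu> / l + 1\<close>, and \<open>1 \<le> \<mu> / l\<close> in this case, which
      yields the factor 3.\<close>
    define q where "q = nat \<lfloor>2 * \<mu> / l\<rfloor> + 1"
    have "0 < 2 * \<mu> / l" "1 \<le> \<mu> / l"
      using sm(1) \<open>0 < \<mu>\<close> False by auto
    then have q: "2 * \<mu> / l < real q" "real q \<le> 3 * \<mu> / l" "0 < q"
      unfolding q_def by linarith+
    have sep: "z = 0" if "x \<in> P" "y \<in> P" "z \<in> M" "x - y = real q *\<^sub>R z" for x y z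
    proof (rule ccontr)
      note xyz = that
      assume "z \<noteq> 0"
      have "x - y \<in> (\<lambda>x. (2 * \<mu>) *\<^sub>R x) ` K"
        using that \<open>0 < \<mu>\<close> by (intro symmetric_convex_body_diff[OF K(1)]) (auto simp: P_def)
      then obtain k where "k \<in> K" "real q *\<^sub>R z = (2 * \<mu>) *\<^sub>R k"
        using xyz(4) by auto
      then have "z = (2 * \<mu> / real q) *\<^sub>R k"
        using \<open>0 < q\<close> by (simp add: divide_inverse_commute flip: scaleR_scaleR)
          (metis scaleR_scaleR left_inverse of_nat_0_less_iff order_less_irrefl scaleR_one)
      then have "l \<le> 2 * \<mu> / real q"
        using sm(3)[of "2 * \<mu> / real q" z] \<open>0 < \<mu>\<close> \<open>z \<in> M\<close> \<open>z \<noteq> 0\<close> \<open>k \<in> K\<close> by auto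
      then show False
        using q(1,3) sm(1) by (simp add: field_simps)
    qed
    have P: "finite P" "card P \<le> q ^ lattice_rank M"
      using card_lattice_points_le[OF M(1) _ q(3) sep, of P] by (auto simp: P_def)
    \<comment> \<open>Discarding the origin is what makes the bound strict.\<close>
    have "0 \<in> P"
      using lattice_zero[OF M(1)] zero_in_symmetric_convex_body[OF K(1) \<open>K \<noteq> {}\<close>]
      by (force simp: P_def)
    then have "card (P - {0}) < card P"
      using P(1) by (meson card_Diff1_less)
    \<comment> \<open>Since \<open>q \<ge> 1\<close>, a rank below \<open>r\<close> only makes the
      count smaller.\<close>
    also have "\<dots> \<le> q ^ r"
      using P(2) q(3) M(4) power_increasing[of "lattice_rank M" r q] by linarith
    finally have "real (card (P - {0})) < real q ^ r"
      by (metis of_nat_less_iff of_nat_power)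
    also have "\<dots> \<le> (3 * \<mu> / l) ^ r"
      using q(2) by (intro power_mono) auto
    finally show ?thesis
      by (simp add: P_def l_def)
  qed
qed

section \<open>Lower bound for lattice points in a dilate\<close>

lemma blichfeldt_symmetric_convex_body:
  fixes K L :: "(real^'n) set"
  assumes K: "o_symmetric_convex_body K" and L: "is_lattice L" "lattice_rank L = CARD('n)"
    and "0 < \<mu>"
    and m: "real m < \<mu> ^ CARD('n) * (measure lebesgue K / (2 ^ CARD('n) * lattice_det L))"
  obtains D where "D \<subseteq> L \<inter> (\<lambda>x. \<mu> *\<^sub>R x) ` K - {0}" "finite D" "card D = 2 * m"
proof -
  \<comment> \<open>Halving the factor puts all differences of points of \<open>S\<close> into
    \<open>\<mu> K\<close>; it accounts for the power of 2 in the hypothesis on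
    \<open>m\<close>.\<close>
  define S where "S = (\<lambda>x. (\<mu> / 2) *\<^sub>R x) ` K"
  have "compact S"
    using K unfolding S_def by (intro compact_scaling) (simp add: o_symmetric_convex_body_def)
  then have S: "bounded S" "S \<in> lmeasurable"
    by (simp_all add: compact_imp_bounded lmeasurable_compact)
  have "measure lebesgue S = (\<mu> / 2) ^ CARD('n) * measure lebesgue K"
    using measure_lebesgue_affine[of "\<mu> / 2" 0 K] \<open>0 < \<mu>\<close> by (simp add: S_def)
  then have "measure lebesgue S * 2 ^ CARD('n) = \<mu> ^ CARD('n) * measure lebesgue K"
    by (simp add: power_divide)
  moreover have "real m * lattice_det L * 2 ^ CARD('n) < \<mu> ^ CARD('n) * measure lebesgue K"
    using m fundamental_cell_lmeasurable_det_pos(2)[OF L] by (simp add: field_simps)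
  ultimately have "real m * lattice_det L < measure lebesgue S"
    by (metis mult_less_cancel_right_pos zero_less_numeral zero_less_power)
  then obtain D where D: "D \<subseteq> L \<inter> {x - y | x y. x \<in> S \<and> y \<in> S} - {0}" "finite D" "card D = 2 * m"
    by (rule blichfeldt_symmetric[OF L S])
  have "{x - y | x y. x \<in> S \<and> y \<in> S} \<subseteq> (\<lambda>x. \<mu> *\<^sub>R x) ` K"
    using symmetric_convex_body_diff[OF K, of "\<mu> / 2"] \<open>0 < \<mu>\<close> by (auto simp: S_def)
  then show ?thesis
    using D by (intro that[of D]) auto
qed

section \<open>Comparison of the two counts\<close>

theorem theorem1p1:
  fixes K \<Lambda> :: "(real ^ 'n) set"
    and M :: "nat \<Rightarrow> (real ^ 'n) set"
    and s :: nat
  assumes "o_symmetric_convex_body K" and "interior K \<noteq> {}"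
    and "is_lattice \<Lambda>" and "lattice_rank \<Lambda> = CARD('n)" and "CARD('n) \<ge> 2"
    and "s \<ge> 1"
    and "\<And>i. i \<in> {1..s} \<Longrightarrow> is_lattice (M i) \<and> M i \<subseteq> \<Lambda>"
    and "\<And>i. i \<in> {1..s} \<Longrightarrow> 1 \<le> lattice_rank (M i) \<and> lattice_rank (M i) \<le> CARD('n) - 1"
  shows "successive_minimum 1 K (\<Lambda> - (\<Union>i\<in>{1..s}. M i))
    < 6 ^ (CARD('n) - 1)
        * (lattice_det \<Lambda> / (successive_minimum 1 K \<Lambda> ^ (CARD('n) - 2) * measure lebesgue K))
        * (\<Sum>i=1..s. 1 / successive_minimum 1 K (M i))
      + root CARD('n) (2 ^ CARD('n) * (lattice_det \<Lambda> / measure lebesgue K))"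
    (is "_ < ?a + ?b")
proof -
  note K = assms(1,2) and L = assms(3,4)
  define n where "n = CARD('n)"
  have n: "2 \<le> n"
    using assms(5) by (simp add: n_def)
  define det vol where "det = lattice_det \<Lambda>" and "vol = measure lebesgue K"
  define l where "l = successive_minimum 1 K \<Lambda>"
  define lM where "lM i = successive_minimum 1 K (M i)" for i
  define \<sigma> where "\<sigma> = (\<Sum>i=1..s. 1 / lM i)"
  \<comment> \<open>\<open>t ^ n * V\<close> is the volume of \<open>(t/2) K\<close> divided by the
    determinant, and \<open>V\<close> is the reciprocal of \<open>b ^ n\<close>.\<close>
  define V where "V = vol / (2 ^ n * det)"
  \<comment> \<open>\<open>A * t ^ (n - 1)\<close> will bound the number of nonzero sublattice
    points in \<open>\<mu> K\<close>, added up over all the sublattices.\<close>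
  define A where "A = 3 ^ (n - 1) / l ^ (n - 2) * \<sigma>"
  define a b where "a = ?a" and "b = ?b"
  have "det > 0"
    using fundamental_cell_lmeasurable_det_pos(2)[OF L] by (simp add: det_def)
  have "K \<in> lmeasurable"
    using K(1) by (simp add: o_symmetric_convex_body_def lmeasurable_compact)
  then have "vol \<noteq> 0"
    using open_not_negligible[OF open_interior K(2)] interior_subset[of K] negligible_subset
    by (metis negligible_iff_measure vol_def)
  then have "vol > 0"
    by (simp add: vol_def zero_less_measure_iff)
  have "V > 0"
    using \<open>det > 0\<close> \<open>vol > 0\<close> by (simp add: V_def)
  have M: "is_lattice (M i)" "M i \<subseteq> \<Lambda>" "1 \<le> lattice_rank (M i)" "lattice_rank (M i) \<le> n - 1"
    if "i \<in> {1..s}" for i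
    using assms(7,8)[OF that] by (auto simp: n_def)
  have "1 \<le> lattice_rank \<Lambda>"
    using L(2) n by (simp add: n_def)
  then obtain x0 where "x0 \<in> \<Lambda>" "x0 \<noteq> 0"
    by (rule lattice_nonzero_point[OF L(1)])
  note l = successive_minimum_one[OF K L order.refl this, folded l_def]
  have lM: "l \<le> lM i" if i: "i \<in> {1..s}" for i
  proof -
    obtain x where x: "x \<in> M i" "x \<noteq> 0"
      by (rule lattice_nonzero_point[OF M(1,3)[OF i]])
    note lMi = successive_minimum_one[OF K L M(2)[OF i] x, folded lM_def]
    then show ?thesis
      using l(3)[of "lM i"] M(2)[OF i] by (meson less_imp_le subsetD)
  qed
  then have lM_pos: "0 < lM i" if "i \<in> {1..s}" for i
    using l(1) that by fastforce
  have "0 < \<sigma>"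
    unfolding \<sigma>_def using lM_pos assms(6) by (intro sum_pos) auto
  \<comment> \<open>This identity explains the constant 6: the factor 3 comes from the upper count,
    the factor 2 from the halved body in the lower count.\<close>
  have a: "2 * a * V = A"
  proof -
    have "(6::real) ^ (n - 1) * 2 = 3 ^ (n - 1) * 2 ^ n"
      using n power_mult_distrib[of "3::real" 2 "n - 1"] power_Suc2[of "2::real" "n - 1"] by simp
    moreover have "a = 6 ^ (n - 1) * (det / (l ^ (n - 2) * vol)) * \<sigma>"
      by (simp add: a_def \<sigma>_def n_def det_def vol_def l_def lM_def)
    ultimately have "2 * a * V = 3 ^ (n - 1) * 2 ^ n * (det / (l ^ (n - 2) * vol)) * \<sigma> * V"
      by (metis mult.assoc mult.commute)
    then show ?thesis
      using \<open>det > 0\<close> \<open>vol > 0\<close> l(1) by (simp add: A_def V_def field_simps)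
  qed
  have "0 < a"
    using a \<open>V > 0\<close> l(1) \<open>0 < \<sigma>\<close> by (smt (verit) A_def divide_pos_pos mult_pos_pos zero_less_mult_pos2 zero_less_power)
  have b_eq: "b = root n (2 ^ n * (det / vol))"
    by (simp add: b_def n_def det_def vol_def)
  then have "0 < b"
    using n \<open>det > 0\<close> \<open>vol > 0\<close> by simp
  have b: "b ^ n * V = 1"
    using n \<open>det > 0\<close> \<open>vol > 0\<close> by (simp add: b_eq V_def)
  define t where "t = a + b"
  have "0 < t" "b \<le> t"
    using \<open>0 < a\<close> \<open>0 < b\<close> by (auto simp: t_def)
  have pow_split: "x ^ n = x * x ^ (n - 1)" for x :: real
    using n by (cases n) auto
  \<comment> \<open>Expanding one factor of \<open>t ^ n\<close> as \<open>a + b\<close> gives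
    \<open>a * t ^ (n - 1) + b * t ^ (n - 1)\<close>, and the second term is at least
    \<open>b ^ n\<close>. After multiplication by \<open>2 V\<close> this becomes
    \<open>tV\<close>.\<close>
  have "b ^ n \<le> b * t ^ (n - 1)"
    unfolding pow_split using \<open>0 < b\<close> \<open>b \<le> t\<close> by (intro mult_left_mono power_mono) auto
  then have "a * t ^ (n - 1) + b ^ n \<le> t ^ n"
    unfolding pow_split[of t] by (simp add: t_def distrib_right)
  then have "(a * t ^ (n - 1) + b ^ n) * V \<le> t ^ n * V"
    using \<open>V > 0\<close> by (intro mult_right_mono) auto
  then have tV: "A * t ^ (n - 1) + 2 \<le> 2 * (t ^ n * V)"
    using b unfolding a[symmetric] by (simp add: algebra_simps)
  \<comment> \<open>The largest integer strictly below \<open>t ^ n * V\<close>. As that number is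
    positive, \<open>nat\<close> truncates nothing.\<close>
  define m where "m = nat (\<lceil>t ^ n * V\<rceil> - 1)"
  have "0 < t ^ n * V"
    using \<open>0 < t\<close> \<open>V > 0\<close> by simp
  then have m: "real m < t ^ n * V" "t ^ n * V \<le> real m + 1"
    unfolding m_def by linarith+
  \<comment> \<open>The gap above \<open>m\<close> leaves room to replace \<open>t\<close> by a
    smaller \<open>\<mu>\<close> that still yields \<open>2 * m\<close> points; hence the strict
    inequality in the claim.\<close>
  then obtain w where w: "real m < w" "w < t ^ n * V"
    using dense by blast
  define \<mu> where "\<mu> = root n (w / V)"
  have "0 < w"
    using w(1) by linarith
  then have \<mu>: "0 < \<mu>" "\<mu> ^ n * V = w"
    using n \<open>V > 0\<close> by (simp_all add: \<mu>_def)
  have "\<mu> < root n (t ^ n)"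
    unfolding \<mu>_def using w(2) n \<open>V > 0\<close> by (simp add: field_simps)
  then have "\<mu> < t"
    using n \<open>0 < t\<close> by (simp add: real_root_power_cancel)
  obtain D where D: "D \<subseteq> \<Lambda> \<inter> (\<lambda>x. \<mu> *\<^sub>R x) ` K - {0}" "finite D" "card D = 2 * m"
    using blichfeldt_symmetric_convex_body[OF K(1) L \<mu>(1), of m] w(1) \<mu>(2)
    unfolding V_def vol_def det_def n_def by metis
  define N where "N i = M i \<inter> (\<lambda>x. \<mu> *\<^sub>R x) ` K - {0}" for i
  have card_N: "real (card (N i)) < 3 ^ (n - 1) / l ^ (n - 2) * t ^ (n - 1) * (1 / lM i)"
    if i: "i \<in> {1..s}" for i
  proof -
    have "real (card (N i)) < (3 * \<mu> / lM i) ^ (n - 1)"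
      unfolding N_def lM_def using card_lattice_points_in_body[OF K L M[OF i] \<mu>(1)] .
    \<comment> \<open>One factor \<open>lM i\<close> is kept for the sum of reciprocals; the other
      \<open>n - 2\<close> are then bounded below by \<open>l\<close>.\<close>
    also have "\<dots> = 3 ^ (n - 1) * \<mu> ^ (n - 1) / (lM i * lM i ^ (n - 2))"
      using n by (simp add: power_divide power_mult_distrib numeral_2_eq_2 Suc_diff_Suc flip: power_Suc)
    also have "\<dots> \<le> 3 ^ (n - 1) * t ^ (n - 1) / (lM i * l ^ (n - 2))"
      using \<open>\<mu> < t\<close> \<mu>(1) l(1) lM[OF i] lM_pos[OF i]
      by (intro frac_le mult_mono power_mono mult_pos_pos zero_less_power) auto
    finally show ?thesis
      by (simp add: field_simps)
  qed
  have "\<exists>x\<in>D. x \<notin> (\<Union>i\<in>{1..s}. M i)"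
  proof (rule ccontr)
    assume "\<not> ?thesis"
    then have "D = (\<Union>i\<in>{1..s}. N i \<inter> D)"
      using D(1) by (auto simp: N_def)
    then have "card D \<le> (\<Sum>i=1..s. card (N i \<inter> D))"
      by (metis card_UN_le finite_atLeastAtMost)
    also have "\<dots> \<le> (\<Sum>i=1..s. card (N i))"
    proof (rule sum_mono)
      fix i assume i: "i \<in> {1..s}"
      have "compact K"
        using K(1) by (simp add: o_symmetric_convex_body_def)
      then have "finite (\<Lambda> \<inter> (\<lambda>x. \<mu> *\<^sub>R x) ` K)"
        by (intro finite_lattice_Int_bounded[OF L] compact_imp_bounded compact_scaling)
      then have "finite (N i)"
        by (rule rev_finite_subset) (use M(2)[OF i] in \<open>auto simp: N_def\<close>)
      then show "card (N i \<inter> D) \<le> card (N i)"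
        by (intro card_mono) auto
    qed
    finally have "real (2 * m) \<le> (\<Sum>i=1..s. real (card (N i)))"
      by (metis D(3) of_nat_le_iff of_nat_sum)
    also have "\<dots> < (\<Sum>i=1..s. 3 ^ (n - 1) / l ^ (n - 2) * t ^ (n - 1) * (1 / lM i))"
      using assms(6) by (intro sum_strict_mono card_N) auto
    also have "\<dots> = A * t ^ (n - 1)"
      unfolding A_def \<sigma>_def sum_distrib_left sum_distrib_right by (intro sum.cong) (simp_all add: mult_ac)
    \<comment> \<open>The chain reads
      \<open>2 m < A * t ^ (n - 1) \<le> 2 (t ^ n * V - 1) \<le> 2 m\<close>.\<close>
    finally show False
      using tV m(2) by linarith
  qed
  then obtain x where x: "x \<in> \<Lambda> - (\<Union>i\<in>{1..s}. M i)" "x \<noteq> 0" "x \<in> (\<lambda>x. \<mu> *\<^sub>R x) ` K"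
    using D(1) by blast
  have "successive_minimum 1 K (\<Lambda> - (\<Union>i\<in>{1..s}. M i)) \<le> \<mu>"
    using successive_minimum_one(3)[OF K L Diff_subset x(1,2)] x \<mu>(1) by (meson less_imp_le)
  also have "\<dots> < t"
    by fact
  finally show ?thesis
    by (simp add: t_def a_def b_def)
qed

end
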